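(* Fix any $L \ge 1$, any $\epsilon \ge 0$, and any $\tau > 0$. If no upper bound on $\|w^*\|$ is known in advance, then no algorithm can guarantee, for every function $f : \mathbb{R} \to \mathbb{R}$ such that (1) $f$ is convex and $L$-smooth, (2) $f$ attains its minimum, with $w^*$ denoting a minimizer of smallest norm, and (3) $\|\nabla f(w)\| \le 3\tau$ for all $w \in \mathbb{R}$, to find a $w \in \mathbb{R}$ with $f(w) \le f(w^* ) + \tau$ by calling an $\epsilon$-AGP oracle for $f$ a finite number of times.
   Context: A differentiable function is $L$-smooth if its gradient is $L$-Lipschitz; on $\mathbb{R}$ the norm is the absolute value. An $\epsilon$-AGP (adversarial gradient perturbation) oracle for $f$ is a procedure that, when called with a point $w$, returns a vector $\mathrm{oracle}(w)$ with $\|\mathrm{oracle}(w) - \nabla f(w)\| \le \epsilon$; the returned vector is otherwise arbitrary (possibly adversarial). An algorithm adaptively chooses query points, each depending only on previous oracle answers (and on the fixed values $L,\epsilon,\tau$), and after finitely many calls outputs a point; the oracle is its only source of information about $f$ beyond membership in the class (1)–(3). "Guarantee" means that the output is correct for every $f$ in the class and every $\epsilon$-AGP oracle for $f$. *)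

theory Defs
  imports "HOL-Analysis.Analysis"
begin

text \<open>The gradient of \<open>f :: real \<Rightarrow> real\<close> is \<^term>\<open>deriv f\<close>, and the norm on
  \<open>real\<close> is the absolute value.  Since \<^term>\<open>deriv f\<close> is unspecified where \<open>f\<close> is not
  differentiable, \<open>L_smooth\<close> requires differentiability everywhere.\<close>

definition L_smooth :: "real \<Rightarrow> (real \<Rightarrow> real) \<Rightarrow> bool" where
  "L_smooth L f \<longleftrightarrow> (\<forall>w. f differentiable (at w)) \<and> L-lipschitz_on UNIV (deriv f)"

definition is_minimizer :: "(real \<Rightarrow> real) \<Rightarrow> real \<Rightarrow> bool" where
  "is_minimizer f w \<longleftrightarrow> (\<forall>v. f w \<le> f v)"

definition min_norm_minimizer :: "(real \<Rightarrow> real) \<Rightarrow> real \<Rightarrow> bool" where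
  "min_norm_minimizer f w \<longleftrightarrow>
     is_minimizer f w \<and> (\<forall>v. is_minimizer f v \<longrightarrow> \<bar>w\<bar> \<le> \<bar>v\<bar>)"

definition agp_oracle :: "real \<Rightarrow> (real \<Rightarrow> real) \<Rightarrow> (real \<Rightarrow> real) \<Rightarrow> bool" where
  "agp_oracle \<epsilon> f orc \<longleftrightarrow> (\<forall>w. \<bar>orc w - deriv f w\<bar> \<le> \<epsilon>)"

text \<open>A deterministic adaptive algorithm is a decision tree: it either outputs a point, or
  queries a point and continues in a way that depends on the answer received.  The continuation
  is an arbitrary function (no computability is required), so the tree may branch infinitely
  and there need not be a uniform bound on the number of calls.  As the datatype is
  inductive, every branch is finite: whatever the answers, an output is produced after
  finitely many calls.\<close>

datatype algorithm = Output real | Query real "real \<Rightarrow> algorithm"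

primrec run :: "(real \<Rightarrow> real) \<Rightarrow> algorithm \<Rightarrow> real" where
  "run orc (Output w) = w"
| "run orc (Query w k) = run orc (k (orc w))"

end

(* The constant oracle -\<tau> drives the algorithm along a single branch of its decision tree, with
   finitely many queries and one output.  A Huber-like function that has slope -\<tau> up to a point
   beyond all of these and only then flattens out gives exactly the same answers, yet its value
   at the output exceeds its minimum by more than \<tau>. *)
theory Submission
  imports Defs
begin

text \<open>A tree may branch infinitely, but one oracle follows a single branch, which is finite.
  \<open>Q\<close> collects the queries on it, so the induction hypothesis is needed only at the
  child \<open>k (orc w)\<close>.\<close>

lemma run_finite_dependence:
  "\<exists>Q. finite Q \<and> (\<forall>orc'. (\<forall>q\<in>Q. orc' q = orc q) \<longrightarrow> run orc' A = run orc A)"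
proof (induction A)
  case (Output w)
  show ?case by (intro exI[of _ "{}"]) simp
next
  case (Query w k)
  obtain Q where fin: "finite Q"
    and Q: "\<And>orc'. \<forall>q\<in>Q. orc' q = orc q \<Longrightarrow> run orc' (k (orc w)) = run orc (k (orc w))"
    using Query[of "k (orc w)"] by blast
  show ?case
  proof (intro exI[of _ "insert w Q"] conjI allI impI)
    show "run orc' (Query w k) = run orc (Query w k)" if "\<forall>q\<in>insert w Q. orc' q = orc q" for orc'
      using that Q[of orc'] by simp
  qed (simp add: fin)
qed

text \<open>An antiderivative of the positive part \<open>max 0 x\<close>, the building block for
  functions with piecewise linear slope.\<close>

definition half_sq_pos :: "real \<Rightarrow> real" where
  "half_sq_pos x = (max 0 x)\<^sup>2 / 2"

lemma DERIV_half_sq_pos: "(half_sq_pos has_real_derivative max 0 x) (at x)"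
proof -
  consider "x < 0" | "x = 0" | "x > 0" by linarith
  then show ?thesis
  proof cases
    case 1
    have "((\<lambda>_. 0) has_real_derivative 0) (at x)" by simp
    then have "(half_sq_pos has_real_derivative 0) (at x)"
      by (rule has_field_derivative_transform_within_open[of _ _ _ "{..<0}"])
        (use 1 in \<open>auto simp: half_sq_pos_def\<close>)
    then show ?thesis using 1 by simp
  next
    case 2
    have "((\<lambda>h. max 0 h / 2) \<longlongrightarrow> max 0 0 / 2) (at (0::real))"
      by (intro tendsto_intros) simp
    \<comment> \<open>This also holds at \<open>h = 0\<close>, where division by zero yields 0, so
      the two sides agree as functions and the limit transfers directly.\<close>
    moreover have "(half_sq_pos (0 + h) - half_sq_pos 0) / h = max 0 h / 2" for h :: real
      by (simp add: half_sq_pos_def max_def power2_eq_square)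
    ultimately show ?thesis using 2 by (simp only: DERIV_def max.idem div_0)
  next
    case 3
    have "((\<lambda>y. y\<^sup>2 / 2) has_real_derivative x) (at x)"
      by (auto intro!: derivative_eq_intros)
    then have "(half_sq_pos has_real_derivative x) (at x)"
      by (rule has_field_derivative_transform_within_open[of _ _ _ "{0<..}"])
        (use 3 in \<open>auto simp: half_sq_pos_def\<close>)
    then show ?thesis using 3 by simp
  qed
qed

text \<open>Subtracting the shifted copy caps the slope: it is \<open>-\<tau>\<close> up to
  \<open>u - \<tau>\<close>, rises at rate 1 to 0 at \<open>u\<close>, and stays 0 from there
  on.\<close>

definition one_sided_huber :: "real \<Rightarrow> real \<Rightarrow> real \<Rightarrow> real" where
  "one_sided_huber \<tau> u w = half_sq_pos (u - w) - half_sq_pos (u - w - \<tau>)"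

context
  fixes \<tau> u :: real
  assumes \<tau>: "\<tau> > 0"
begin

lemma DERIV_one_sided_huber:
  "(one_sided_huber \<tau> u has_real_derivative - min \<tau> (max 0 (u - w))) (at w)"
proof -
  have "((\<lambda>w. half_sq_pos (u - w) - half_sq_pos (u - w - \<tau>)) has_real_derivative
          max 0 (u - w) * (-1) - max 0 (u - w - \<tau>) * (-1)) (at w)"
    by (intro DERIV_diff DERIV_chain2[OF DERIV_half_sq_pos]) (auto intro!: derivative_eq_intros)
  moreover have "max 0 (u - w) * (-1) - max 0 (u - w - \<tau>) * (-1) = - min \<tau> (max 0 (u - w))"
    using \<tau> by (auto simp: max_def min_def)
  ultimately show ?thesis by (simp add: one_sided_huber_def[abs_def])
qed

lemma deriv_one_sided_huber: "deriv (one_sided_huber \<tau> u) w = - min \<tau> (max 0 (u - w))"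
  by (rule DERIV_imp_deriv[OF DERIV_one_sided_huber])

lemma convex_one_sided_huber: "convex_on UNIV (one_sided_huber \<tau> u)"
  by (rule convex_on_realI[OF _ DERIV_one_sided_huber]) (simp, linarith)

text \<open>The derivative is a clipped affine function of slope 1, hence 1-Lipschitz, and
  \<open>L \<ge> 1\<close> weakens the constant.\<close>

lemma L_smooth_one_sided_huber:
  assumes "L \<ge> 1"
  shows "L_smooth L (one_sided_huber \<tau> u)"
  unfolding L_smooth_def
proof
  show "\<forall>w. one_sided_huber \<tau> u differentiable at w"
    using DERIV_one_sided_huber real_differentiable_def by blast
  have "1-lipschitz_on UNIV (deriv (one_sided_huber \<tau> u))"
  proof (rule lipschitz_onI)
    show "dist (deriv (one_sided_huber \<tau> u) x) (deriv (one_sided_huber \<tau> u) y) \<le> 1 * dist x y"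
      for x y
      unfolding deriv_one_sided_huber dist_real_def
      using \<tau> by (simp add: min_def max_def abs_if)
  qed simp
  then show "L-lipschitz_on UNIV (deriv (one_sided_huber \<tau> u))"
    using assms lipschitz_on_le by blast
qed

lemma one_sided_huber_eq_0: "u \<le> w \<Longrightarrow> one_sided_huber \<tau> u w = 0"
  using \<tau> by (simp add: one_sided_huber_def half_sq_pos_def)

lemma one_sided_huber_pos:
  assumes "w < u"
  shows "one_sided_huber \<tau> u w > 0"
proof -
  have "(max 0 (u - w - \<tau>))\<^sup>2 < (u - w)\<^sup>2"
    by (rule power_strict_mono) (use \<tau> assms in auto)
  then show ?thesis using assms by (simp add: one_sided_huber_def half_sq_pos_def)
qed

lemma one_sided_huber_linear:
  "w \<le> u - \<tau> \<Longrightarrow> one_sided_huber \<tau> u w = \<tau> * (u - w) - \<tau>\<^sup>2 / 2"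
  using \<tau> by (simp add: one_sided_huber_def half_sq_pos_def power2_eq_square field_simps)

text \<open>The function vanishes from \<open>u\<close> on and is positive before, so its minimizers
  form the ray starting at \<open>u\<close>; as \<open>u \<ge> 0\<close>, its endpoint has the
  smallest norm.\<close>

lemma min_norm_minimizer_one_sided_huber:
  assumes "u \<ge> 0"
  shows "min_norm_minimizer (one_sided_huber \<tau> u) u"
proof -
  have "one_sided_huber \<tau> u u \<le> one_sided_huber \<tau> u v" for v
    using one_sided_huber_eq_0[of u] one_sided_huber_eq_0[of v] one_sided_huber_pos[of v]
    by (cases "v < u") auto
  moreover have "u \<le> v" if "is_minimizer (one_sided_huber \<tau> u) v" for v
    using that one_sided_huber_eq_0[of u] one_sided_huber_pos[of v]
    unfolding is_minimizer_def by (metis order_refl not_le)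
  ultimately show ?thesis
    using assms unfolding min_norm_minimizer_def is_minimizer_def[of _ u] by force
qed

end

theorem theorem1:
  fixes L \<epsilon> \<tau> :: real
  assumes "L \<ge> 1" and "\<epsilon> \<ge> 0" and "\<tau> > 0"
  shows "\<not> (\<exists>A :: algorithm. \<forall>(f :: real \<Rightarrow> real) wstar :: real.
            convex_on UNIV f \<and> L_smooth L f \<and>
            min_norm_minimizer f wstar \<and>
            (\<forall>w. \<bar>deriv f w\<bar> \<le> 3 * \<tau>) \<longrightarrow>
            (\<forall>orc. agp_oracle \<epsilon> f orc \<longrightarrow> f (run orc A) \<le> f wstar + \<tau>))"
proof (rule notI, elim exE)
  fix A :: algorithm
  assume A: "\<forall>(f :: real \<Rightarrow> real) wstar :: real.
            convex_on UNIV f \<and> L_smooth L f \<and>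
            min_norm_minimizer f wstar \<and>
            (\<forall>w. \<bar>deriv f w\<bar> \<le> 3 * \<tau>) \<longrightarrow>
            (\<forall>orc. agp_oracle \<epsilon> f orc \<longrightarrow> f (run orc A) \<le> f wstar + \<tau>)"
  \<comment> \<open>The branch and its output are fixed before the hard function is chosen, so that
    function may depend on both.\<close>
  define out where "out = run (\<lambda>_. - \<tau>) A"
  have "\<exists>Q. finite Q \<and> (\<forall>orc. (\<forall>q\<in>Q. orc q = - \<tau>) \<longrightarrow> run orc A = out)"
    unfolding out_def by (rule run_finite_dependence)
  then obtain Q where "finite Q"
    and Q: "\<forall>orc. (\<forall>q\<in>Q. orc q = - \<tau>) \<longrightarrow> run orc A = out"
    by (elim exE conjE)
  \<comment> \<open>The entry 0 makes the minimizer \<open>R + \<tau>\<close> nonnegative,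
    \<open>out + 2\<close> forces a large value at the output, and \<open>Q\<close> keeps every
    query in the linear part.\<close>
  define R where "R = Max (insert 0 (insert (out + 2) Q))"
  have R: "0 \<le> R" "out + 2 \<le> R" "\<And>q. q \<in> Q \<Longrightarrow> q \<le> R"
    unfolding R_def using \<open>finite Q\<close> by (auto intro!: Max_ge simp del: Max_insert)
  \<comment> \<open>The shift by \<open>\<tau>\<close> makes the slope equal to
    \<open>-\<tau>\<close> on all of \<open>w \<le> R\<close>.\<close>
  define f where "f = one_sided_huber \<tau> (R + \<tau>)"
  note deriv_f = deriv_one_sided_huber[OF assms(3), of "R + \<tau>", folded f_def]
  \<comment> \<open>The exact gradient is itself an admissible oracle, and on \<open>Q\<close> it
    answers \<open>-\<tau>\<close>.\<close>
  have "run (deriv f) A = out"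
  proof (rule Q[rule_format])
    show "deriv f q = - \<tau>" if "q \<in> Q" for q
      using R(3)[OF that] assms(3) unfolding deriv_f by linarith
  qed
  moreover have "f (run (deriv f) A) \<le> f (R + \<tau>) + \<tau>"
  proof (rule A[rule_format], intro conjI allI)
    show "convex_on UNIV f"
      unfolding f_def by (rule convex_one_sided_huber[OF assms(3)])
    show "L_smooth L f"
      unfolding f_def by (rule L_smooth_one_sided_huber[OF assms(3) assms(1)])
    show "min_norm_minimizer f (R + \<tau>)"
      unfolding f_def by (rule min_norm_minimizer_one_sided_huber[OF assms(3)])
        (use R(1) assms(3) in linarith)
    show "\<bar>deriv f w\<bar> \<le> 3 * \<tau>" for w
      using assms(3) unfolding deriv_f by linarith
    show "agp_oracle \<epsilon> f (deriv f)"
      using assms(2) by (simp add: agp_oracle_def)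
  qed
  moreover have "f (R + \<tau>) = 0"
    unfolding f_def by (rule one_sided_huber_eq_0[OF assms(3)]) simp
  moreover have "f out > \<tau>"
  proof -
    have "f out = \<tau> * (R + \<tau> - out) - \<tau>\<^sup>2 / 2"
      unfolding f_def by (rule one_sided_huber_linear[OF assms(3)]) (use R(2) in simp)
    also have "\<dots> = \<tau> * (R - out) + \<tau>\<^sup>2 / 2"
      by (simp add: power2_eq_square algebra_simps)
    \<comment> \<open>The margin \<open>R - out \<ge> 2\<close> already contributes
      \<open>2 * \<tau>\<close>, which exceeds \<open>\<tau>\<close>.\<close>
    also have "\<dots> > \<tau> * 1"
      using mult_left_mono[of 2 "R - out" \<tau>] R(2) assms(3) zero_le_power2[of \<tau>] by linarith
    finally show ?thesis by simp
  qed
  ultimately show False by simp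
qed

end
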